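(* Suppose that $P_t(\mathbb{N})>\frac12$ for every odd positive integer $t$ whose binary expansion $t=(t_1t_2\dots t_n)_2$ (with leading digit $t_1=1$) has second digit $t_2=0$. Then $\mu_t(\mathbb{N})>\frac12$ for every $t\in\mathbb{N}$.
   Context: $\mathbb{N}=\{0,1,2,\dots\}$. For $n\in\mathbb{N}$, $s(n)$ is the number of ones in the binary expansion of $n$. For $t\in\mathbb{N}$, $d\in\mathbb{Z}$, $\mu_t(d)=\lim_{N\to\infty}\frac1N|\{n<N: s(n+t)-s(n)=d\}|$; it is well known that the limit exists and $\mu_t$ is a probability measure on $\mathbb{Z}$ with mean zero. The probability measures $P_t$ on $\mathbb{Z}$, $t\ge1$, are defined recursively by $P_1=\delta_0$, $P_{2t}=P_t$ for $t\ge 1$, and $P_{2t+1}(d)=\frac12P_{t+1}(d+1)+\frac12P_t(d-1)$ for $t\ge1$, $d\in\mathbb{Z}$. *)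

theory Defs
  imports "HOL-Analysis.Analysis" "HOL-Library.Log_Nat"
begin

definition s :: "nat \<Rightarrow> nat" where
  "s n = card {i. bit n i}"

definition mu :: "nat \<Rightarrow> int \<Rightarrow> real" where
  "mu t d = lim (\<lambda>N. real (card {n. n < N \<and> int (s (n + t)) - int (s n) = d}) / real N)"

text \<open>The value at \<open>t = 0\<close> is a dummy; the measures are meant for \<open>t \<ge> 1\<close> only.\<close>

function P :: "nat \<Rightarrow> int \<Rightarrow> real" where
  "P t d =
    (if t = 0 then 0
     else if t = 1 then (if d = 0 then 1 else 0)
     else if even t then P (t div 2) d
     else P (t div 2 + 1) (d + 1) / 2 + P (t div 2) (d - 1) / 2)"
  by pat_completeness auto
termination
proof (relation "Wellfounded.measure fst", goal_cases)
  case (3 t d)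
  then show ?case by (auto elim!: oddE)
qed auto

declare P.simps [simp del]

lemma P_recursion:
  "P 1 d = (if d = 0 then 1 else 0)"
  "t \<ge> 1 \<Longrightarrow> P (2 * t) d = P t d"
  "t \<ge> 1 \<Longrightarrow> P (2 * t + 1) d = 1/2 * P (t + 1) (d + 1) + 1/2 * P t (d - 1)"
  by (simp_all add: P.simps[of "Suc 0"] P.simps[of "2 * t"] P.simps[of "Suc (2 * t)"])

text \<open>Binary digits are numbered from the leading one: \<open>t = (t\<^sub>1 t\<^sub>2 \<dots> t\<^sub>n)\<^sub>2\<close>
  with \<open>n = floorlog 2 t\<close>; meaningful for \<open>1 \<le> i \<le> n\<close>.\<close>

definition bin_digit :: "nat \<Rightarrow> nat \<Rightarrow> nat" where
  "bin_digit t i = of_bool (bit t (floorlog 2 t - i))"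

text \<open>The measure of a set of integers, for a measure on the integers given by its point masses.\<close>

definition mass :: "(int \<Rightarrow> real) \<Rightarrow> int set \<Rightarrow> real" where
  "mass f A = (\<Sum>\<^sub>\<infinity>d\<in>A. f d)"

end

(* For t fixed and k large, the measures P (2^k + t) converge to mu t: both satisfy the same
   recursion in t, so only t = 1 has to be compared. In fact P (2^k + t) d = mu t d as soon as
   d + k is large relative to t, so for large k the two measures agree on all natural numbers.
   Since the second binary digit of 2^k + t is 0 for large k, the hypothesis applies to every
   odd t; even t are reduced to t / 2. *)

theory Submission
  imports Defs "HOL-Real_Asymp.Real_Asymp"
begin

section \<open>Natural densities\<close>

text \<open>\<open>mu\<close> is a \<open>lim\<close>, which says nothing unless the limit exists.
  Keeping existence and value in one predicate lets a single recursion yield both.\<close>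

definition has_density :: "(nat \<Rightarrow> bool) \<Rightarrow> real \<Rightarrow> bool" where
  "has_density Q a \<longleftrightarrow> (\<lambda>N. real (card {n. n < N \<and> Q n}) / real N) \<longlonglongrightarrow> a"

lemma has_density_True: "has_density (\<lambda>n. True) 1"
proof -
  have "\<forall>\<^sub>F N in sequentially. real (card {n. n < N \<and> True}) / real N = 1"
    using eventually_gt_at_top[of 0] by eventually_elim simp
  then show ?thesis
    unfolding has_density_def by (rule tendsto_eventually)
qed

lemma has_density_False: "has_density (\<lambda>n. False) 0"
  by (simp add: has_density_def)

lemma card_less_split_parity:
  fixes N :: nat
  shows "card {n. n < N \<and> Q n} =
    card {m. m < (N + 1) div 2 \<and> Q (2 * m)} + card {m. m < N div 2 \<and> Q (2 * m + 1)}"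
proof -
  let ?A = "{m. m < (N + 1) div 2 \<and> Q (2 * m)}" and ?B = "{m. m < N div 2 \<and> Q (2 * m + 1)}"
  have split: "{n. n < N \<and> Q n} = (\<lambda>m. 2 * m) ` ?A \<union> (\<lambda>m. 2 * m + 1) ` ?B"
  proof (intro equalityI subsetI)
    fix n assume n: "n \<in> {n. n < N \<and> Q n}"
    show "n \<in> (\<lambda>m. 2 * m) ` ?A \<union> (\<lambda>m. 2 * m + 1) ` ?B"
    proof (cases "even n")
      case True
      then obtain m where "n = 2 * m" by blast
      with n show ?thesis by auto
    next
      case False
      then obtain m where "n = 2 * m + 1" by (rule oddE)
      with n show ?thesis by auto
    qed
  qed auto
  have "card ((\<lambda>m. 2 * m) ` ?A \<union> (\<lambda>m. 2 * m + 1) ` ?B)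
      = card ((\<lambda>m. 2 * m) ` ?A) + card ((\<lambda>m. 2 * m + 1) ` ?B)"
    by (rule card_Un_disjoint) (auto, presburger)
  also have "\<dots> = card ?A + card ?B"
    by (simp add: card_image inj_on_def)
  finally show ?thesis
    by (simp only: split)
qed

text \<open>Among the numbers below N about half are even and half are odd, so each parity class
  enters with weight 1/2.\<close>

lemma has_density_interleave:
  assumes "has_density (\<lambda>m. Q (2 * m)) a" and "has_density (\<lambda>m. Q (2 * m + 1)) b"
  shows "has_density Q ((a + b) / 2)"
proof -
  let ?A = "\<lambda>M. real (card {m. m < M \<and> Q (2 * m)})"
  let ?B = "\<lambda>M. real (card {m. m < M \<and> Q (2 * m + 1)})"
  have f1: "filterlim (\<lambda>N::nat. (N + 1) div 2) at_top sequentially"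
    unfolding filterlim_at_top
  proof
    fix M :: nat
    show "\<forall>\<^sub>F N in sequentially. M \<le> (N + 1) div 2"
      by (rule eventually_sequentiallyI[of "2 * M"]) linarith
  qed
  have f2: "filterlim (\<lambda>N::nat. N div 2) at_top sequentially"
    unfolding filterlim_at_top
  proof
    fix M :: nat
    show "\<forall>\<^sub>F N in sequentially. M \<le> N div 2"
      by (rule eventually_sequentiallyI[of "2 * M"]) linarith
  qed
  have l1: "(\<lambda>N. real ((N + 1) div 2) / real N) \<longlonglongrightarrow> 1/2"
    by real_asymp
  have l2: "(\<lambda>N. real (N div 2) / real N) \<longlonglongrightarrow> 1/2"
    by real_asymp
  have "(\<lambda>N. ?A ((N + 1) div 2) / real ((N + 1) div 2) * (real ((N + 1) div 2) / real N)
      + ?B (N div 2) / real (N div 2) * (real (N div 2) / real N)) \<longlonglongrightarrow> a * (1/2) + b * (1/2)"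
    using assms unfolding has_density_def
    by (intro tendsto_add tendsto_mult l1 l2 filterlim_compose[OF _ f1] filterlim_compose[OF _ f2])
  \<comment> \<open>For M = 0 the quotient is 0 by convention, but the count is 0 as well, so M
    cancels in every case.\<close>
  moreover have "?A M / real M * (real M / c) = ?A M / c" "?B M / real M * (real M / c) = ?B M / c"
    for M c by (cases "M = 0"; simp)+
  ultimately have "(\<lambda>N. ?A ((N + 1) div 2) / real N + ?B (N div 2) / real N) \<longlonglongrightarrow> a * (1/2) + b * (1/2)"
    by (simp only:)
  then show ?thesis
    unfolding has_density_def card_less_split_parity[of _ Q] by (simp add: add_divide_distrib)
qed

section \<open>The binary digit sum\<close>

lemma s_double: "s (2 * n) = s n"
proof -
  have "{i. bit (2 * n) i} = Suc ` {i. bit n i}"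
  proof (intro equalityI subsetI)
    fix i assume "i \<in> {i. bit (2 * n) i}"
    then show "i \<in> Suc ` {i. bit n i}" by (cases i) (auto simp: bit_Suc bit_0)
  qed (auto simp: bit_Suc)
  then show ?thesis
    by (simp add: s_def card_image)
qed

lemma finite_bits_nat: "finite {i. bit (n::nat) i}"
proof (rule finite_subset)
  show "{i. bit n i} \<subseteq> {..n}"
  proof clarify
    fix i assume "bit n i"
    then have "2 ^ i \<le> n"
      by (metis bit_iff_odd div_less even_zero not_le)
    then show "i \<le> n"
      using less_exp[of i] by linarith
  qed
qed simp

lemma s_double_plus_1: "s (2 * n + 1) = s n + 1"
proof -
  have "{i. bit (2 * n + 1) i} = insert 0 (Suc ` {i. bit n i})"
  proof (intro equalityI subsetI)
    fix i assume "i \<in> {i. bit (2 * n + 1) i}"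
    then show "i \<in> insert 0 (Suc ` {i. bit n i})" by (cases i) (auto simp: bit_Suc)
  qed (auto simp: bit_Suc bit_0)
  then show ?thesis
    using finite_bits_nat by (simp add: s_def card_image)
qed

text \<open>An even n gains a final one; for odd n the final one is lost and the carry passes to n
  div 2. The bound rules out increments d \<ge> 2 under a shift by 1.\<close>

lemma s_Suc_le: "s (n + 1) \<le> s n + 1"
proof (induction n rule: less_induct)
  case (less n)
  show ?case
  proof (cases "even n")
    case True
    then obtain m where "n = 2 * m" by blast
    then show ?thesis
      using s_double[of m] s_double_plus_1[of m] by simp
  next
    case False
    then obtain m where m: "n = 2 * m + 1" by (rule oddE)
    then have "s (n + 1) = s (m + 1)"
      using s_double[of "m + 1"] by simp
    with m less.IH[of m] s_double_plus_1[of m] show ?thesis by simp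
  qed
qed

section \<open>Recursion for the densities of increments of \<open>s\<close>\<close>

abbreviation s_shift_by :: "nat \<Rightarrow> int \<Rightarrow> nat \<Rightarrow> bool" where
  "s_shift_by t d n \<equiv> int (s (n + t)) - int (s n) = d"

lemma mu_eqI: "has_density (s_shift_by t d) a \<Longrightarrow> mu t d = a"
  unfolding has_density_def mu_def by (rule limI)

text \<open>Adding 2t keeps the last digit of n and adds t to the remaining ones.\<close>

lemma has_density_shift_double:
  assumes "has_density (s_shift_by t d) a"
  shows "has_density (s_shift_by (2 * t) d) a"
proof -
  have "s_shift_by (2 * t) d (2 * m) = s_shift_by t d m" for m
    using s_double[of m] s_double[of "m + t"] by (simp add: algebra_simps)
  moreover have "s_shift_by (2 * t) d (2 * m + 1) = s_shift_by t d m" for m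
    using s_double_plus_1[of m] s_double_plus_1[of "m + t"] by (simp add: algebra_simps)
  ultimately have "has_density (s_shift_by (2 * t) d) ((a + a) / 2)"
    using assms by (intro has_density_interleave) simp_all
  then show ?thesis by simp
qed

text \<open>An even n = 2m becomes 2(m + t) + 1 and gains a final one; an odd n = 2m + 1 becomes 2(m
  + t + 1), losing its final one to a carry.\<close>

lemma has_density_shift_double_plus_1:
  assumes "has_density (s_shift_by (t + 1) (d + 1)) a" and "has_density (s_shift_by t (d - 1)) b"
  shows "has_density (s_shift_by (2 * t + 1) d) (1/2 * a + 1/2 * b)"
proof -
  have "s_shift_by (2 * t + 1) d (2 * m) = s_shift_by t (d - 1) m" for m
    using s_double[of m] s_double_plus_1[of "m + t"] by (simp add: algebra_simps)
  moreover have "s_shift_by (2 * t + 1) d (2 * m + 1) = s_shift_by (t + 1) (d + 1) m" for m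
    using s_double_plus_1[of m] s_double[of "m + t + 1"] by (simp add: algebra_simps)
  ultimately have "has_density (s_shift_by (2 * t + 1) d) ((b + a) / 2)"
    using assms by (intro has_density_interleave) simp_all
  then show ?thesis by (simp add: field_simps)
qed

lemma has_density_shift_0: "has_density (s_shift_by 0 d) (if d = 0 then 1 else 0)"
  using has_density_True has_density_False by (cases "d = 0") simp_all

section \<open>Comparison with the measures \<open>P\<close>\<close>

lemma P_power2: "P (2 ^ k) d = (if d = 0 then 1 else 0)"
  by (induction k) (simp_all add: P_recursion(1,2)[simplified])

text \<open>Both sides obey the same recursion, which trades k for k - 1 and d for d + 1 and so
  preserves d + k. It ends at k = 0 with d \<ge> 2, where \<open>P 2\<close> and the density both
  vanish; at d = 1 the density would be 1/2, hence the constant 2.\<close>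

lemma has_density_shift_1:
  assumes "2 \<le> d + int k"
  shows "has_density (s_shift_by 1 d) (P (2 ^ k + 1) d)"
  using assms
proof (induction k arbitrary: d)
  case 0
  have "P (2 ^ 0 + 1) d = 0"
    using 0 P_power2[of 1 d] by (simp add: numeral_2_eq_2)
  moreover have "\<not> s_shift_by 1 d n" for n
    using s_Suc_le[of n] 0 by simp
  ultimately show ?case
    using has_density_False by simp
next
  case (Suc k)
  have "P (2 ^ Suc k + 1) d = 1/2 * P (2 ^ k + 1) (d + 1) + 1/2 * P (2 ^ k) (d - 1)"
    using P_recursion(3)[of "2 ^ k" d] by simp
  moreover have "has_density (s_shift_by (0 + 1) (d + 1)) (P (2 ^ k + 1) (d + 1))"
    using Suc by simp
  moreover have "has_density (s_shift_by 0 (d - 1)) (P (2 ^ k) (d - 1))"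
    using has_density_shift_0[of "d - 1"] by (simp only: P_power2)
  ultimately show ?case
    using has_density_shift_double_plus_1[of 0 d] by simp
qed

text \<open>The bound t \<le> k + 1 ensures that k is positive as long as t > 1, so that
  \<open>2 ^ k\<close> can be halved along with t. One recursion step lowers d + k by at most 2 and
  2t by at least 2, so the last hypothesis survives down to t = 1, where it reads 2 \<le> d +
  k.\<close>

lemma has_density_shift_P:
  assumes "1 \<le> t" and "t \<le> k + 1" and "2 * int t \<le> d + int k"
  shows "has_density (s_shift_by t d) (P (2 ^ k + t) d)"
  using assms
proof (induction t arbitrary: k d rule: less_induct)
  case (less t)
  show ?case
  proof (cases "t = 1")
    case True
    with less.prems show ?thesis
      using has_density_shift_1[of d k] by simp
  next
    case False
    with less.prems obtain j where k: "k = Suc j"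
      by (cases k) auto
    show ?thesis
    proof (cases "even t")
      case True
      then obtain u where u: "t = 2 * u" by blast
      have "has_density (s_shift_by u d) (P (2 ^ j + u) d)"
        using less.prems u k by (intro less.IH) auto
      then have "has_density (s_shift_by t d) (P (2 ^ j + u) d)"
        unfolding u by (rule has_density_shift_double)
      moreover have "P (2 ^ k + t) d = P (2 ^ j + u) d"
        using P_recursion(2)[of "2 ^ j + u" d] less.prems by (simp add: u k)
      ultimately show ?thesis by simp
    next
      case odd: False
      then obtain u where u: "t = 2 * u + 1" by (rule oddE)
      have "has_density (s_shift_by (u + 1) (d + 1)) (P (2 ^ j + (u + 1)) (d + 1))"
        using less.prems u k False by (intro less.IH) auto
      moreover have "has_density (s_shift_by u (d - 1)) (P (2 ^ j + u) (d - 1))"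
        using less.prems u k False by (intro less.IH) auto
      ultimately have "has_density (s_shift_by t d)
          (1/2 * P (2 ^ j + (u + 1)) (d + 1) + 1/2 * P (2 ^ j + u) (d - 1))"
        unfolding u by (rule has_density_shift_double_plus_1)
      moreover have "P (2 ^ k + t) d
          = 1/2 * P (2 ^ j + (u + 1)) (d + 1) + 1/2 * P (2 ^ j + u) (d - 1)"
        using P_recursion(3)[of "2 ^ j + u" d] less.prems False
        by (simp add: u k algebra_simps)
      ultimately show ?thesis by simp
    qed
  qed
qed

section \<open>Consequences for \<open>mu\<close>\<close>

lemma mu_0: "mu 0 d = (if d = 0 then 1 else 0)"
  using has_density_shift_0 by (rule mu_eqI)

lemma mu_double:
  assumes "1 \<le> t"
  shows "mu (2 * t) d = mu t d"
proof -
  \<comment> \<open>Any exponent meeting both bounds of \<open>has_density_shift_P\<close> would do: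
    the value of \<open>P\<close> only witnesses that the density exists.\<close>
  let ?a = "P (2 ^ nat (2 * int t + \<bar>d\<bar>) + t) d"
  have "has_density (s_shift_by t d) ?a"
    using assms by (intro has_density_shift_P) auto
  then show ?thesis
    using has_density_shift_double[of t d ?a] by (simp add: mu_eqI)
qed

text \<open>As t stays below the two top positions, the expansion of \<open>2 ^ k + t\<close> starts
  with 10.\<close>

lemma second_digit_power2_plus:
  assumes "1 \<le> k" and "t < 2 ^ (k - 1)"
  shows "floorlog 2 (2 ^ k + t) = k + 1" and "bin_digit (2 ^ k + t) 2 = 0"
proof -
  obtain j where k: "k = Suc j"
    using assms(1) by (cases k) auto
  with assms(2) have t: "t < 2 ^ j" by simp
  show log: "floorlog 2 (2 ^ k + t) = k + 1"
    using t by (intro antisym floorlog_leI floorlog_geI) (simp_all add: k)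
  have "bin_digit (2 ^ k + t) 2 = of_bool (bit (2 ^ k + t) j)"
    unfolding bin_digit_def log by (simp add: k)
  moreover have "(2 ^ k + t) div 2 ^ j = 2"
    using t by (simp add: k)
  ultimately show "bin_digit (2 ^ k + t) 2 = 0"
    by (simp add: bit_iff_odd)
qed

theorem mainTheorem10:
  assumes "\<And>t::nat. odd t \<Longrightarrow> floorlog 2 t \<ge> 2 \<Longrightarrow> bin_digit t 2 = 0 \<Longrightarrow> mass (P t) \<nat> > 1/2"
  shows "\<forall>t::nat. mass (mu t) \<nat> > 1/2"
proof
  fix t :: nat
  show "mass (mu t) \<nat> > 1/2"
  proof (induction t rule: less_induct)
    case (less t)
    consider "t = 0" | u where "1 \<le> u" "t = 2 * u" | "odd t"
      by (metis One_nat_def Suc_leI evenE mult_0_right neq0_conv)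
    then show ?case
    proof cases
      case 1
      have "mass (mu 0) \<nat> = (\<Sum>\<^sub>\<infinity>d\<in>{0}. mu 0 d)"
        unfolding mass_def by (rule infsum_cong_neutral) (auto simp: mu_0)
      also have "\<dots> = 1" by (simp add: mu_0)
      finally show ?thesis by (simp only: 1)
    next
      case 2
      then have "mu t = mu u"
        using mu_double by auto
      with 2 less.IH[of u] show ?thesis by simp
    next
      case 3
      then have t: "1 \<le> t" by (simp add: odd_pos Suc_leI)
      \<comment> \<open>The exponent 2t is chosen so that 2t \<le> d + k holds with k = 2t for every
        d \<ge> 0 at once; \<open>2 ^ (2 * t)\<close> is even, so adding it keeps t odd.\<close>
      have "t < 2 ^ t" by (rule less_exp)
      also have "(2::nat) ^ t \<le> 2 ^ (2 * t - 1)"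
        using t by (intro power_increasing) auto
      finally have "floorlog 2 (2 ^ (2 * t) + t) = 2 * t + 1" "bin_digit (2 ^ (2 * t) + t) 2 = 0"
        using t second_digit_power2_plus[of "2 * t" t] by simp_all
      then have "mass (P (2 ^ (2 * t) + t)) \<nat> > 1/2"
        using 3 t by (intro assms) auto
      \<comment> \<open>The point masses agree exactly on the naturals, so the strict inequality
        carries over without any passage to a limit.\<close>
      also have "mass (P (2 ^ (2 * t) + t)) \<nat> = mass (mu t) \<nat>"
        unfolding mass_def
      proof (rule infsum_cong)
        fix d :: int assume "d \<in> \<nat>"
        then have "0 \<le> d" by (rule Nats_induct) auto
        then have "has_density (s_shift_by t d) (P (2 ^ (2 * t) + t) d)"
          using t by (intro has_density_shift_P) auto
        then show "P (2 ^ (2 * t) + t) d = mu t d"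
          by (simp add: mu_eqI)
      qed
      finally show ?thesis .
    qed
  qed
qed

end
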